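(* If $c\geq 2$ and $k\geq 1$, then $\mathit{fw}(I_{c}^{k}D_{c})=c+2k-1$.
   Context: A sequence $s$ contains a sequence $u$ if some subsequence of $s$ can be changed into $u$ by a one-to-one renaming of its letters. An $(r,s)$-formation is a concatenation of $s$ permutations of the same set of $r$ distinct letters. The formation width $\mathit{fw}(u)$ is the minimum $s$ such that there exists $r$ for which every $(r,s)$-formation contains $u$. $I_c$ denotes $1\,2\ldots c$, $D_c$ denotes $c\,(c-1)\ldots 1$, and $I_c^k$ is $I_c$ concatenated $k$ times. *)

theory Defs
  imports "HOL-Library.Sublist" "HOL-Combinatorics.Multiset_Permutations"
begin

definition contains :: "'a list \<Rightarrow> 'b list \<Rightarrow> bool" where
  "contains s u \<longleftrightarrow> (\<exists>v g. subseq v s \<and> inj_on g (set v) \<and> map g v = u)"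

definition is_formation :: "nat \<Rightarrow> nat \<Rightarrow> 'a list \<Rightarrow> bool" where
  "is_formation r s f \<longleftrightarrow>
     (\<exists>A ps. finite A \<and> card A = r \<and> length ps = s \<and> set ps \<subseteq> permutations_of_set A \<and> f = concat ps)"

text \<open>
  The letters of the formations range over an infinite type, so that \<open>(r, s)\<close>-formations
  exist for every \<open>r\<close> and the inner quantifier is never vacuous.  Which infinite type is used
  does not matter, since containment is invariant under renaming of letters.
\<close>
definition fw :: "'b list \<Rightarrow> nat" where
  "fw u = (LEAST s. \<exists>r. \<forall>f :: nat list. is_formation r s f \<longrightarrow> contains f u)"

definition I_word :: "nat \<Rightarrow> nat list" where
  "I_word c = [1..<Suc c]"

definition D_word :: "nat \<Rightarrow> nat list" where
  "D_word c = rev [1..<Suc c]"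

end

theory Submission
  imports Defs
begin

text \<open>
  Upper bound: applying the Erdos--Szekeres theorem once per block gives \<open>c\<close> letters on which every
  block is either increasing or decreasing. Among \<open>c + 2 * k - 1\<close> such blocks, say with a decreasing
  last one, either \<open>k\<close> blocks are increasing, and these together with the last block contain
  \<open>I\<^sub>c\<^sup>k D\<^sub>c\<close>; or at least \<open>c + k\<close> are decreasing, and then \<open>k\<close> of them contain \<open>D\<^sub>c\<^sup>k\<close> while \<open>c\<close>
  further blocks contain \<open>I\<^sub>c\<close>, one letter each.

  Lower bound: take \<open>2 * k - 2\<close> blocks that alternate between increasing and decreasing, followed by
  increasing blocks only. In an embedded copy of \<open>X\<^sup>k (rev X)\<close>, every return to the first two letters
  of \<open>X\<close> costs two blocks, and afterwards every pair of adjacent letters of \<open>X\<close> is a descent either in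
  the last copy of \<open>X\<close> or in its reversal.
\<close>

section \<open>Containment as an injective embedding of the pattern\<close>

lemma contains_iff:
  "contains s u \<longleftrightarrow> (\<exists>h. inj_on h (set u) \<and> subseq (map h u) s)"
proof
  assume "contains s u"
  then obtain v g where v: "subseq v s" "inj_on g (set v)" "map g v = u"
    unfolding contains_def by blast
  let ?h = "inv_into (set v) g"
  have "map ?h u = v"
    using v by (auto intro!: map_idI)
  moreover have "inj_on ?h (set u)"
    using v(3) by (auto intro: inj_on_inv_into)
  ultimately show "\<exists>h. inj_on h (set u) \<and> subseq (map h u) s"
    using v(1) by metis
next
  assume "\<exists>h. inj_on h (set u) \<and> subseq (map h u) s"
  then obtain h where h: "inj_on h (set u)" "subseq (map h u) s" by blast
  have "map (inv_into (set u) h) (map h u) = u"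
    using h(1) by (auto intro!: map_idI)
  moreover have "inj_on (inv_into (set u) h) (set (map h u))"
    by (auto intro: inj_on_inv_into)
  ultimately show "contains s u"
    unfolding contains_def using h(2) by blast
qed

section \<open>Letters on which every block is monotone\<close>

lemma subseq_imp_subseq_rev: "subseq xs ys \<Longrightarrow> subseq (rev xs) (rev ys)"
  by (induction rule: list_emb.induct) (auto intro: list_emb_append_mono subseq_rev_drop_many)

lemma subseq_imp_set_subset: "subseq xs ys \<Longrightarrow> set xs \<subseteq> set ys"
  by (auto dest: list_emb_set)

text \<open>The head \<open>x\<close> of \<open>xs\<close> splits the other letters into those after
  it in \<open>p\<close> and those before it. It extends a list that follows the order of
  \<open>p\<close> in the first class, and a list that reverses it in the second. Keeping the larger
  class costs a factor 2 per step; this crude bound suffices, since only the existence of some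
  \<open>r\<close> matters.\<close>

lemma erdos_szekeres_subseq:
  assumes "distinct xs" "set xs \<subseteq> set p" "2 ^ (a + b) \<le> length xs"
  shows "\<exists>ys. subseq ys xs \<and>
           (length ys = a \<and> subseq ys p \<or> length ys = b \<and> subseq (rev ys) p)"
  using assms
proof (induction "a + b" arbitrary: a b xs p)
  case 0
  then show ?case by (intro exI[of _ "[]"]) simp
next
  case (Suc n)
  show ?case
  proof (cases "a = 0 \<or> b = 0")
    case True
    then show ?thesis by (intro exI[of _ "[]"]) auto
  next
    case False
    then obtain a' b' where ab: "a = Suc a'" "b = Suc b'"
      by (meson not0_implies_Suc)
    from Suc.prems(3) obtain x xs' where xs: "xs = x # xs'"
      by (cases xs) auto
    then obtain p1 p2 where p: "p = p1 @ x # p2"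
      using Suc.prems(2) by (auto dest!: split_list)
    let ?later = "filter (\<lambda>y. y \<in> set p2) xs'"
    let ?earlier = "filter (\<lambda>y. y \<notin> set p2) xs'"
    have "length ?later + length ?earlier = length xs'"
      by (rule sum_length_filter_compl)
    moreover have "2 ^ n + 2 ^ n \<le> Suc (length xs')"
      using Suc.prems(3) Suc.hyps(2) xs by (metis length_Cons mult_2 power_Suc)
    \<comment> \<open>Together the two classes have at least \<open>2 * 2 ^ n - 1\<close> letters,
      so they cannot both have fewer than \<open>2 ^ n\<close>.\<close>
    ultimately consider "2 ^ n \<le> length ?later" | "2 ^ n \<le> length ?earlier"
      by linarith
    then show ?thesis
    proof cases
      case 1
      have "\<exists>ys. subseq ys ?later \<and>
              (length ys = a' \<and> subseq ys p2 \<or> length ys = b \<and> subseq (rev ys) p2)"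
        using Suc.prems Suc.hyps(2) xs ab 1 by (intro Suc.hyps(1)) auto
      then obtain ys where ys: "subseq ys ?later"
        "length ys = a' \<and> subseq ys p2 \<or> length ys = b \<and> subseq (rev ys) p2" by blast
      have sub: "subseq ys xs'"
        using ys(1) subseq_filter_left subseq_order.order_trans by blast
      from ys(2) show ?thesis
      proof
        assume "length ys = a' \<and> subseq ys p2"
        then show ?thesis
          using sub xs p ab by (intro exI[of _ "x # ys"]) auto
      next
        assume "length ys = b \<and> subseq (rev ys) p2"
        then show ?thesis
          using sub xs p by (intro exI[of _ ys]) (auto intro: subseq_drop_many)
      qed
    next
      case 2
      have "set ?earlier \<subseteq> set p1"
        using Suc.prems(1,2) xs p by auto
      then have "\<exists>ys. subseq ys ?earlier \<and>
              (length ys = a \<and> subseq ys p1 \<or> length ys = b' \<and> subseq (rev ys) p1)"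
        using Suc.prems Suc.hyps(2) xs ab 2 by (intro Suc.hyps(1)) auto
      then obtain ys where ys: "subseq ys ?earlier"
        "length ys = a \<and> subseq ys p1 \<or> length ys = b' \<and> subseq (rev ys) p1" by blast
      have sub: "subseq ys xs'"
        using ys(1) subseq_filter_left subseq_order.order_trans by blast
      from ys(2) show ?thesis
      proof
        assume "length ys = a \<and> subseq ys p1"
        then show ?thesis
          using sub xs p by (intro exI[of _ ys]) (auto intro: subseq_rev_drop_many)
      next
        assume "length ys = b' \<and> subseq (rev ys) p1"
        then show ?thesis
          using sub xs p ab by (intro exI[of _ "x # ys"]) (auto intro!: list_emb_append_mono)
      qed
    qed
  qed
qed

text \<open>Induction on the number of blocks: \<open>2 ^ (n + n)\<close> letters that suit all
  blocks but one are thinned to \<open>n\<close> letters that suit the remaining block too. Passing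
  to a subsequence keeps the orientations already obtained.\<close>

lemma monotone_in_all_blocks:
  "\<exists>R. \<forall>A ps. length ps = s \<longrightarrow> finite A \<longrightarrow> R \<le> card A \<longrightarrow> (\<forall>p\<in>set ps. set p = A) \<longrightarrow>
     (\<exists>xs. distinct xs \<and> length xs = n \<and> set xs \<subseteq> A \<and>
        (\<forall>p\<in>set ps. subseq xs p \<or> subseq (rev xs) p))"
proof (induction s arbitrary: n)
  case 0
  have "\<exists>xs. distinct xs \<and> length xs = n \<and> set xs \<subseteq> A" if "finite A" "n \<le> card A" for A :: "'a set"
    using that obtain_subset_with_card_n finite_distinct_list
    by (metis distinct_card)
  then show ?case by auto
next
  case (Suc s)
  obtain R where R: "\<And>(A :: 'a set) ps. length ps = s \<Longrightarrow> finite A \<Longrightarrow> R \<le> card A \<Longrightarrow>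
      \<forall>p\<in>set ps. set p = A \<Longrightarrow>
      \<exists>xs. distinct xs \<and> length xs = 2 ^ (n + n) \<and> set xs \<subseteq> A \<and>
        (\<forall>p\<in>set ps. subseq xs p \<or> subseq (rev xs) p)"
    using Suc.IH[of "2 ^ (n + n)"] by blast
  show ?case
  proof (intro exI[of _ R] allI impI)
    fix A :: "'a set" and ps :: "'a list list"
    assume A: "length ps = Suc s" "finite A" "R \<le> card A" "\<forall>p\<in>set ps. set p = A"
    then obtain q qs where ps: "ps = q # qs" by (cases ps) auto
    obtain xs where xs: "distinct xs" "length xs = 2 ^ (n + n)" "set xs \<subseteq> A"
      "\<forall>p\<in>set qs. subseq xs p \<or> subseq (rev xs) p"
      using R[of qs A] A ps by auto
    obtain ys where ys: "subseq ys xs" "length ys = n" "subseq ys q \<or> subseq (rev ys) q"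
      using erdos_szekeres_subseq[of xs q n n] xs A(4) ps by auto
    have "subseq ys p \<or> subseq (rev ys) p" if "p \<in> set qs" for p
      using that xs(4) ys(1) by (meson subseq_order.order_trans subseq_imp_subseq_rev)
    moreover have "distinct ys"
      using ys(1) xs(1) distinct_nthsI unfolding subseq_conv_nths by blast
    moreover have "set ys \<subseteq> A"
      using subseq_imp_set_subset[OF ys(1)] xs(3) by (rule order_trans)
    ultimately show "\<exists>xs. distinct xs \<and> length xs = n \<and> set xs \<subseteq> A \<and>
        (\<forall>p\<in>set ps. subseq xs p \<or> subseq (rev xs) p)"
      using ys(2,3) ps by auto
  qed
qed

section \<open>Upper bound: the pattern inside monotone blocks\<close>

lemma subseq_concat_replicate:
  assumes "\<forall>p\<in>set ps. subseq ys p" "n \<le> length ps"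
  shows "subseq (concat (replicate n ys)) (concat ps)"
  using assms
proof (induction ps arbitrary: n)
  case (Cons p ps)
  then show ?case
    by (cases n) (auto intro!: list_emb_append_mono)
qed simp

lemma subseq_concat_one_letter_per_block:
  assumes "\<forall>p\<in>set ps. set ys \<subseteq> set p" "length ys \<le> length ps"
  shows "subseq ys (concat ps)"
  using assms
proof (induction ps arbitrary: ys)
  case (Cons p ps)
  show ?case
  proof (cases ys)
    case (Cons y ys')
    then have "subseq [y] p" "subseq ys' (concat ps)"
      using Cons.prems Cons.IH[of ys'] by (auto simp: subseq_singleton_left)
    then show ?thesis
      using Cons list_emb_append_mono[of "(=)" "[y]" p ys'] by auto
  qed simp
qed simp

lemma subseq_concat_filter: "subseq (concat (filter P ps)) (concat ps)"
  by (induction ps) (auto intro: list_emb_append_mono list_emb_append2)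

lemma power_rev_in_monotone_blocks:
  assumes mono: "\<forall>p\<in>set as. subseq ys p \<or> subseq (rev ys) p"
    and last: "subseq (rev ys) q"
    and len: "length ys + 2 * k \<le> length as + 2"
  shows "\<exists>zs\<in>{ys, rev ys}. subseq (concat (replicate k zs) @ rev zs) (concat (as @ [q]))"
proof (cases "k \<le> length (filter (subseq ys) as)")
  case True
  have "subseq (concat (replicate k ys)) (concat (filter (subseq ys) as))"
    using True by (intro subseq_concat_replicate) auto
  then have "subseq (concat (replicate k ys)) (concat as)"
    using subseq_concat_filter subseq_order.order_trans by blast
  then show ?thesis
    using last by (auto intro!: list_emb_append_mono)
next
  case False
  define bs where "bs = filter (subseq (rev ys)) (as @ [q])"
  have "length as - length (filter (subseq ys) as) \<le> length (filter (subseq (rev ys)) as)"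
  proof -
    have "filter (\<lambda>p. \<not> subseq ys p) as = filter (\<lambda>p. \<not> subseq ys p) (filter (subseq (rev ys)) as)"
      using mono by (auto intro!: filter_cong)
    then have "length (filter (\<lambda>p. \<not> subseq ys p) as) \<le> length (filter (subseq (rev ys)) as)"
      by (metis length_filter_le)
    then show ?thesis
      using sum_length_filter_compl[of "subseq ys" as] by linarith
  qed
  \<comment> \<open>At most \<open>k - 1\<close> blocks of \<open>as\<close> contain
    \<open>ys\<close>, so at least \<open>length as - (k - 1)\<close> contain \<open>rev ys\<close>,
    and \<open>q\<close> is one more.\<close>
  then have lenbs: "length ys + k \<le> length bs"
    using False len last by (simp add: bs_def)
  have bs: "subseq (rev ys) p" if "p \<in> set bs" for p
    using that unfolding bs_def by (simp only: set_filter mem_Collect_eq)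
  have "subseq (concat (replicate k (rev ys))) (concat (take k bs))"
    using bs lenbs by (intro subseq_concat_replicate) (auto dest: in_set_takeD)
  \<comment> \<open>The orientation of these spare blocks does not matter: each supplies a single
    letter of \<open>ys\<close>.\<close>
  moreover have "subseq ys (concat (drop k bs))"
  proof (rule subseq_concat_one_letter_per_block)
    show "\<forall>p\<in>set (drop k bs). set ys \<subseteq> set p"
      using bs subseq_imp_set_subset by (metis in_set_dropD set_rev)
  qed (use lenbs in simp)
  ultimately have "subseq (concat (replicate k (rev ys)) @ ys) (concat bs)"
    by (metis append_take_drop_id concat_append list_emb_append_mono)
  then have "subseq (concat (replicate k (rev ys)) @ ys) (concat (as @ [q]))"
    unfolding bs_def using subseq_concat_filter subseq_order.order_trans by blast
  then show ?thesis by auto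
qed

lemma contains_power_rev:
  assumes "distinct zs" "length zs = c"
    and "subseq (concat (replicate k zs) @ rev zs) s"
  shows "contains s (concat (replicate k (I_word c)) @ D_word c)"
proof -
  define h where "h i = zs ! (i - 1)" for i
  have I: "map h (I_word c) = zs"
    using assms(2) by (intro nth_equalityI) (auto simp: I_word_def h_def simp del: upt_Suc)
  have "map h (concat (replicate k (I_word c)) @ D_word c) = concat (replicate k zs) @ rev zs"
    using I by (simp add: map_concat D_word_def I_word_def rev_map[symmetric] del: upt_Suc)
  moreover have "inj_on h {1..c}"
    using assms(1,2) by (auto simp: inj_on_def h_def nth_eq_iff_index_eq)
  moreover have "set (concat (replicate k (I_word c)) @ D_word c) \<subseteq> {1..c}"
    by (auto simp: I_word_def D_word_def simp del: upt_Suc split: if_splits)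
  ultimately show ?thesis
    unfolding contains_iff using assms(3) inj_on_subset by metis
qed

lemma formation_contains_power_rev:
  assumes "k \<ge> 1"
  shows "\<exists>r. \<forall>f :: nat list. is_formation r (c + 2 * k - 1) f \<longrightarrow>
           contains f (concat (replicate k (I_word c)) @ D_word c)"
proof -
  obtain R where R: "\<And>(A :: nat set) ps. length ps = c + 2 * k - 1 \<Longrightarrow> finite A \<Longrightarrow> R \<le> card A \<Longrightarrow>
      \<forall>p\<in>set ps. set p = A \<Longrightarrow>
      \<exists>xs. distinct xs \<and> length xs = c \<and> set xs \<subseteq> A \<and>
        (\<forall>p\<in>set ps. subseq xs p \<or> subseq (rev xs) p)"
    using monotone_in_all_blocks[of "c + 2 * k - 1" c] by blast
  show ?thesis
  proof (intro exI[of _ R] allI impI)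
    fix f :: "nat list"
    assume "is_formation R (c + 2 * k - 1) f"
    then obtain A ps where f: "finite A" "card A = R" "length ps = c + 2 * k - 1"
      "set ps \<subseteq> permutations_of_set A" "f = concat ps"
      unfolding is_formation_def by blast
    have "\<forall>p\<in>set ps. set p = A"
      using f(4) permutations_of_setD(1) by blast
    then obtain xs where xs: "distinct xs" "length xs = c"
      "\<forall>p\<in>set ps. subseq xs p \<or> subseq (rev xs) p"
      using R[of ps A] f by auto
    \<comment> \<open>By \<open>k \<ge> 1\<close> the number of blocks is positive, so there is a
      last one.\<close>
    obtain as q where ps: "ps = as @ [q]"
      using f(3) assms by (cases ps rule: rev_cases) auto
    \<comment> \<open>Reversing \<open>xs\<close> if necessary, the last block is the one that runs
      backwards.\<close>
    obtain ys where ys: "ys \<in> {xs, rev xs}" "subseq (rev ys) q"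
      using xs(3) ps by (metis in_set_conv_decomp insertCI rev_rev_ident)
    have "\<forall>p\<in>set as. subseq ys p \<or> subseq (rev ys) p"
      using xs(3) ps ys(1) by auto
    moreover have "length ys + 2 * k \<le> length as + 2"
      using f(3) ps xs(2) ys(1) by auto
    ultimately obtain zs where zs: "zs \<in> {ys, rev ys}"
      "subseq (concat (replicate k zs) @ rev zs) f"
      using power_rev_in_monotone_blocks[of as ys q k] ys(2) ps f(5) by blast
    have "distinct zs" "length zs = c"
      using zs(1) ys(1) xs by auto
    then show "contains f (concat (replicate k (I_word c)) @ D_word c)"
      using zs(2) by (rule contains_power_rev)
  qed
qed

section \<open>Block indices of an embedded word\<close>

text \<open>Here \<open>\<beta> i\<close> is the block that hosts letter \<open>i\<close> of
  \<open>v\<close>. It turns the lower bound into inequalities between indices, where an increase is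
  forced whenever two letters do not fit into one block in the required order.\<close>

lemma subseq_concat_block_index:
  assumes "subseq v (concat ps)"
  shows "\<exists>\<beta>. (\<forall>i<length v. \<beta> i < length ps) \<and>
    (\<forall>i j. i < j \<longrightarrow> j < length v \<longrightarrow>
       \<beta> i \<le> \<beta> j \<and> (\<beta> i = \<beta> j \<longrightarrow> subseq [v ! i, v ! j] (ps ! \<beta> i)))"
  using assms
proof (induction ps arbitrary: v rule: rev_induct)
  case Nil
  then have "v = []" by simp
  then show ?case by simp
next
  case (snoc p ps)
  then obtain us ws where v: "v = us @ ws" "subseq us (concat ps)" "subseq ws p"
    by (auto elim: subseq_appendE)
  from snoc.IH[OF v(2)] obtain \<beta> where \<beta>: "\<And>i. i < length us \<Longrightarrow> \<beta> i < length ps"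
    "\<And>i j. i < j \<Longrightarrow> j < length us \<Longrightarrow> \<beta> i \<le> \<beta> j"
    "\<And>i j. i < j \<Longrightarrow> j < length us \<Longrightarrow> \<beta> i = \<beta> j \<Longrightarrow> subseq [us ! i, us ! j] (ps ! \<beta> i)"
    by blast
  define \<gamma> where "\<gamma> i = (if i < length us then \<beta> i else length ps)" for i
  have pair: "subseq [ws ! i, ws ! j] p" if "i < j" "j < length ws" for i j
  proof -
    have "ws = take i ws @ ws ! i # drop (Suc i) ws"
      using that by (simp add: id_take_nth_drop)
    moreover have "ws ! j \<in> set (drop (Suc i) ws)"
      using that by (auto simp: in_set_conv_nth intro!: exI[of _ "j - Suc i"])
    ultimately have "subseq [ws ! i, ws ! j] ws"
      by (metis list_emb_append2 subseq_Cons2 subseq_singleton_left)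
    then show ?thesis
      using v(3) subseq_order.order_trans by blast
  qed
  have "\<gamma> i \<le> \<gamma> j \<and> (\<gamma> i = \<gamma> j \<longrightarrow> subseq [v ! i, v ! j] ((ps @ [p]) ! \<gamma> i))"
    if ij: "i < j" "j < length v" for i j
  proof (cases "j < length us")
    case True
    then show ?thesis
      using ij \<beta> by (auto simp: \<gamma>_def v(1) nth_append)
  next
    case False
    show ?thesis
    proof (cases "i < length us")
      case True
      then show ?thesis
        using \<beta>(1)[of i] False by (auto simp: \<gamma>_def)
    next
      case i: False
      then show ?thesis
        using False ij pair[of "i - length us" "j - length us"]
        by (auto simp: \<gamma>_def v(1) nth_append)
    qed
  qed
  moreover have "\<gamma> i < length (ps @ [p])" for i
    using \<beta>(1)[of i] by (auto simp: \<gamma>_def)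
  ultimately show ?case by blast
qed

lemma subseq_pair_upt: "subseq [a, b] [0..<n] \<Longrightarrow> a < b"
proof (induction n)
  case (Suc n)
  then obtain us vs where "[a, b] = us @ vs" "subseq us [0..<n]" "subseq vs [n]"
    by (auto elim: subseq_appendE)
  then show ?case
    using Suc.IH subseq_imp_set_subset[of us "[0..<n]"] subseq_imp_set_subset[of vs "[n]"]
    by (cases us; cases "tl us") auto
qed simp

lemma nth_concat_replicate:
  assumes "t < k" "i < length xs"
  shows "concat (replicate k xs) ! (t * length xs + i) = xs ! i"
  using assms
proof (induction k arbitrary: t)
  case (Suc k)
  then show ?case
    by (cases t) (auto simp: nth_append)
qed simp

lemma nth_power_rev:
  "t < k \<Longrightarrow> i < c \<Longrightarrow> (concat (replicate k (I_word c)) @ D_word c) ! (t * c + i) = Suc i"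
  "i < c \<Longrightarrow> (concat (replicate k (I_word c)) @ D_word c) ! (k * c + i) = c - i"
proof -
  have len: "length (concat (replicate k (I_word c))) = k * c"
    by (simp add: length_concat I_word_def sum_list_replicate del: upt_Suc)
  show "(concat (replicate k (I_word c)) @ D_word c) ! (t * c + i) = Suc i" if "t < k" "i < c"
  proof -
    have "t * c + i < Suc t * c" using that by simp
    also have "\<dots> \<le> k * c" using that by (intro mult_le_mono1) simp
    finally show ?thesis
      using that nth_concat_replicate[of t k i "I_word c"] len
      by (simp add: nth_append I_word_def del: upt_Suc)
  qed
  show "(concat (replicate k (I_word c)) @ D_word c) ! (k * c + i) = c - i" if "i < c"
    using that len by (simp add: nth_append D_word_def rev_nth del: upt_Suc)
qed

section \<open>Lower bound: a formation that needs many blocks\<close>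

text \<open>Indices start at 0, so the alternating part begins with an increasing block and ends
  with a decreasing one, of index \<open>2 * k - 3\<close>. For \<open>k = 1\<close> it is
  empty.\<close>

definition avoiding_block :: "nat \<Rightarrow> nat \<Rightarrow> nat \<Rightarrow> nat list" where
  "avoiding_block k r j = (if odd j \<and> j < 2 * k - 2 then rev [0..<r] else [0..<r])"

lemma subseq_pair_avoiding_block:
  assumes "subseq [a, b] (avoiding_block k r j)"
  shows "if odd j \<and> j < 2 * k - 2 then b < a else a < b"
proof (cases "odd j \<and> j < 2 * k - 2")
  case True
  then have "subseq (rev [b, a]) (rev [0..<r])"
    using assms by (simp add: avoiding_block_def)
  then show ?thesis
    using True by (metis subseq_pair_upt subseq_imp_subseq_rev rev_rev_ident)
next
  case False
  then have "subseq [a, b] [0..<r]"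
    using assms by (simp only: avoiding_block_def if_False)
  then show ?thesis
    using False subseq_pair_upt by auto
qed

text \<open>The last letter lies in a block of index at least
  \<open>(2 * k - 2) + 1 + (c - 1)\<close>: the terms come from the returns to the first two
  letters, from the letter repeated at the turning point, and from the adjacent pairs.\<close>

lemma length_ge_if_contains_power_rev:
  assumes c: "c \<ge> 2" and k: "k \<ge> 1"
    and cont: "contains (concat (map (avoiding_block k r) [0..<s]))
                 (concat (replicate k (I_word c)) @ D_word c)"
  shows "c + 2 * k - 1 \<le> s"
proof -
  let ?u = "concat (replicate k (I_word c)) @ D_word c"
  let ?ps = "map (avoiding_block k r) [0..<s]"
  obtain h where h: "inj_on h (set ?u)" "subseq (map h ?u) (concat ?ps)"
    using cont unfolding contains_iff by blast
  have len: "length ?u = k * c + c"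
    by (simp add: length_concat I_word_def D_word_def sum_list_replicate del: upt_Suc)
  obtain \<beta> where range: "\<forall>i<length (map h ?u). \<beta> i < length ?ps"
    and pairs: "\<forall>i j. i < j \<longrightarrow> j < length (map h ?u) \<longrightarrow> \<beta> i \<le> \<beta> j \<and>
      (\<beta> i = \<beta> j \<longrightarrow> subseq [map h ?u ! i, map h ?u ! j] (?ps ! \<beta> i))"
    using subseq_concat_block_index[OF h(2)] by (elim exE conjE)
  have len_map: "length (map h ?u) = k * c + c"
    using len by (simp only: length_map)
  have \<beta>: "\<beta> i < s" if "i < k * c + c" for i
    using range that unfolding len_map by simp
  have mono: "\<beta> i \<le> \<beta> j" if "i < j" "j < k * c + c" for i j
    using pairs that unfolding len_map by blast
  have same: "subseq [h (?u ! i), h (?u ! j)] (?ps ! \<beta> i)"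
    if "i < j" "j < k * c + c" "\<beta> i = \<beta> j" for i j
  proof -
    have "subseq [map h ?u ! i, map h ?u ! j] (?ps ! \<beta> i)"
      using pairs that unfolding len_map by blast
    moreover have "map h ?u ! i = h (?u ! i)" "map h ?u ! j = h (?u ! j)"
      using that len by (simp_all only: nth_map)
    ultimately show ?thesis by simp
  qed
  \<comment> \<open>\<open>y\<close> is the embedded word by position; \<open>X\<close> is the image
    of one copy of \<open>I_word c\<close>, indexed from 0.\<close>
  define y where "y i = h (?u ! i)" for i
  define X where "X i = h (Suc i)" for i
  have forward: "y (t * c + i) = X i" if "t < k" "i < c" for t i
    using nth_power_rev(1)[OF that] by (simp add: y_def X_def)
  have backward: "y (k * c + i) = X (c - 1 - i)" if "i < c" for i
    using nth_power_rev(2)[OF that, of k] that by (simp add: y_def X_def Suc_diff_Suc)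
  have X_neq: "X i \<noteq> X (Suc i)" if "Suc i < c" for i
  proof -
    have "Suc i \<in> set ?u" "Suc (Suc i) \<in> set ?u"
      using that by (auto simp: D_word_def simp del: upt_Suc)
    from inj_on_eq_iff[OF h(1) this] show ?thesis
      by (simp add: X_def)
  qed
  have in_block: "if odd (\<beta> i) \<and> \<beta> i < 2 * k - 2 then y j < y i else y i < y j"
    if "i < j" "j < k * c + c" "\<beta> i = \<beta> j" for i j
    using same[OF that] \<beta>[of i] that unfolding y_def by (intro subseq_pair_avoiding_block) simp

  \<comment> \<open>\<open>e t i\<close> is the block of letter \<open>i\<close> of copy
    \<open>t\<close>, and \<open>D i\<close> counts the descents among \<open>X 0\<close>, ...,
    \<open>X i\<close>.\<close>
  define e where "e t i = \<beta> (t * c + i)" for t i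
  define D where "D i = (\<Sum>j<i. if X (Suc j) < X j then 1 else 0 :: nat)" for i
  have idx: "t * c + i < k * c" if "t < k" "i < c" for t i
  proof -
    have "t * c + i < Suc t * c" using that by simp
    also have "\<dots> \<le> k * c" using that by (intro mult_le_mono1) simp
    finally show ?thesis .
  qed
  have step: "e t i \<le> e t (Suc i)" if "t < k" "Suc i < c" for t i
    unfolding e_def using idx[OF that] by (intro mono) auto
  have step_same: "if odd (e t i) \<and> e t i < 2 * k - 2 then X (Suc i) < X i else X i < X (Suc i)"
    if "e t i = e t (Suc i)" "t < k" "Suc i < c" for t i
    using in_block[of "t * c + i" "t * c + Suc i"] idx[OF that(2,3)] that
      forward[of t i] forward[of t "Suc i"] unfolding e_def by (simp split: if_splits)
  \<comment> \<open>Only the first two letters of each copy are followed from copy to copy: they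
    read \<open>X 0\<close>, \<open>X 1\<close>, \<open>X 0\<close>, \<open>X 1\<close>, and so on,
    alternately rising and falling.\<close>
  have wrap: "e t 1 \<le> e (Suc t) 0" if "Suc t < k" for t
    unfolding e_def using idx[OF that, of 0] c by (intro mono; simp only: mult_Suc; linarith)
  have wrap_same: "if odd (e t 1) \<and> e t 1 < 2 * k - 2 then X 0 < X 1 else X 1 < X 0"
    if "e t 1 = e (Suc t) 0" "Suc t < k" for t
    using in_block[of "t * c + 1" "Suc t * c + 0"] idx[OF that(2), of 0] that c
      forward[of t 1] forward[of "Suc t" 0] unfolding e_def by (simp split: if_splits)

  have X01: "X 0 < X 1 \<or> X 1 < X 0"
    using X_neq[of 0] c by auto
  have D1: "D 1 = (if X 1 < X 0 then 1 else 0)"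
    by (simp add: D_def)
  have step0: "e t 0 \<le> e t 1" if "t < k" for t
    using step[OF that, of 0] c by simp
  have step0_same: "if odd (e t 0) \<and> e t 0 < 2 * k - 2 then X 1 < X 0 else X 0 < X 1"
    if "e t 0 = e t 1" "t < k" for t
    using step_same[of t 0] that c by simp
  \<comment> \<open>The term \<open>D 1\<close> arises because block 0 is increasing and cannot host
    a descent from \<open>X 0\<close> to \<open>X 1\<close>.\<close>
  have first_pair: "2 * t + D 1 \<le> e t 1" if "t < k" for t
    using that
  proof (induction t)
    case 0
    then show ?case
      using step0_same[of 0] step0[of 0] D1 by (cases "e 0 1 = 0") auto
  next
    case (Suc t)
    then have IH: "2 * t + D 1 \<le> e t 1" by simp
    have s: "e (Suc t) 0 \<le> e (Suc t) 1" using step0 Suc.prems by simp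
    have w: "e t 1 \<le> e (Suc t) 0" using wrap Suc.prems by simp
    have t: "2 * t + 1 < 2 * k - 2" using Suc.prems by simp
    show ?case
    proof (cases "X 0 < X 1")
      case True
      then have D: "D 1 = 0" using D1 by simp
      \<comment> \<open>The increasing block \<open>2 * t\<close> cannot host \<open>X 1\<close>
        before \<open>X 0\<close>, and the decreasing block \<open>2 * t + 1\<close> cannot host
        \<open>X 0\<close> before \<open>X 1\<close>. The other case is the same, one block
        later.\<close>
      have "e (Suc t) 0 \<noteq> 2 * t"
        using wrap_same[of t] w IH D Suc.prems True by (auto split: if_splits)
      moreover have "\<not> (e (Suc t) 0 = 2 * t + 1 \<and> e (Suc t) 1 = 2 * t + 1)"
        using step0_same[of "Suc t"] Suc.prems True t by (auto split: if_splits)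
      ultimately show ?thesis using IH D w s by arith
    next
      case False
      then have X10: "X 1 < X 0" using X01 by simp
      then have D: "D 1 = 1" using D1 by simp
      have "e (Suc t) 0 \<noteq> 2 * t + 1"
        using wrap_same[of t] w IH D Suc.prems X10 t by (auto split: if_splits)
      moreover have "\<not> (e (Suc t) 0 = 2 * t + 2 \<and> e (Suc t) 1 = 2 * t + 2)"
        using step0_same[of "Suc t"] Suc.prems X10 by (auto split: if_splits)
      ultimately show ?thesis using IH D w s by arith
    qed
  qed

  \<comment> \<open>From index \<open>2 * k - 2\<close> on all blocks are increasing, so each
    descent of \<open>X\<close> forces a new block.\<close>
  have last_copy: "2 * k - 2 + D (Suc i) \<le> e (k - 1) (Suc i)" if "Suc i < c" for i
    using that
  proof (induction i)
    case 0
    have "2 * (k - 1) + D 1 \<le> e (k - 1) 1"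
      using first_pair[of "k - 1"] k by simp
    then show ?case by (simp add: diff_mult_distrib2)
  next
    case (Suc i)
    then have IH: "2 * k - 2 + D (Suc i) \<le> e (k - 1) (Suc i)" by simp
    have s: "e (k - 1) (Suc i) \<le> e (k - 1) (Suc (Suc i))"
      using step[of "k - 1" "Suc i"] Suc.prems k by simp
    have "e (k - 1) (Suc i) \<noteq> e (k - 1) (Suc (Suc i))" if "X (Suc (Suc i)) < X (Suc i)"
      using step_same[of "k - 1" "Suc i"] that IH Suc.prems k by (auto split: if_splits)
    moreover have "D (Suc (Suc i)) = D (Suc i) + (if X (Suc (Suc i)) < X (Suc i) then 1 else 0)"
      by (simp add: D_def)
    ultimately show ?case
      using IH s by (cases "X (Suc (Suc i)) < X (Suc i)") auto
  qed

  \<comment> \<open>Going back over a pair, an ascent of \<open>X\<close> has become a descent and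
    forces a new block; a descent of \<open>X\<close> was already paid for in the last copy, and
    dropping it from \<open>D\<close> balances the growth of \<open>i\<close>.\<close>
  have reversal: "2 * k - 1 + i + D (c - 1 - i) \<le> \<beta> (k * c + i)" if "i < c" for i
    using that
  proof (induction i)
    case 0
    define m where "m = (k - 1) * c + (c - 1)"
    have m: "Suc m = k * c"
      using k c unfolding m_def by (cases k) auto
    have b: "2 * k - 2 + D (c - 1) \<le> \<beta> m"
      using last_copy[of "c - 2"] c unfolding e_def m_def by (simp add: Suc_diff_Suc numeral_2_eq_2)
    \<comment> \<open>The last copy ends with the letter that starts its reversal, and no block
      contains a letter twice.\<close>
    have "y m = y (k * c)"
      using forward[of "k - 1" "c - 1"] backward[of 0] k c unfolding m_def by simp
    then have "\<beta> m \<noteq> \<beta> (k * c)"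
      using in_block[of m "k * c"] m c by (auto split: if_splits)
    moreover have "\<beta> m \<le> \<beta> (k * c)"
      using mono[of m "k * c"] m c by simp
    ultimately show ?case using b k by simp
  next
    case (Suc i)
    let ?j = "c - 1 - Suc i"
    have j: "c - 1 - i = Suc ?j" using Suc.prems by simp
    have IH: "2 * k - 1 + i + D (Suc ?j) \<le> \<beta> (k * c + i)"
      using Suc j by simp
    have s: "\<beta> (k * c + i) \<le> \<beta> (k * c + Suc i)"
      using mono[of "k * c + i" "k * c + Suc i"] Suc.prems by simp
    have neq: "\<beta> (k * c + i) \<noteq> \<beta> (k * c + Suc i)" if "X ?j < X (Suc ?j)"
    proof
      assume "\<beta> (k * c + i) = \<beta> (k * c + Suc i)"
      then have "X (Suc ?j) < X ?j"
        using in_block[of "k * c + i" "k * c + Suc i"] IH Suc.prems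
          backward[of i] backward[of "Suc i"] j by (auto split: if_splits)
      with that show False by simp
    qed
    have D: "D (Suc ?j) = D ?j + (if X (Suc ?j) < X ?j then 1 else 0)"
      by (simp add: D_def)
    have X_j: "X (Suc ?j) \<noteq> X ?j"
    proof -
      have "Suc ?j < c" using Suc.prems by linarith
      from X_neq[OF this] show ?thesis by simp
    qed
    show ?case
      using X_j IH s neq D by (cases "X (Suc ?j) < X ?j") auto
  qed
  \<comment> \<open>At the final letter \<open>i = c - 1\<close>, the bound is at least
    \<open>2 * k + c - 2\<close>, and this index is strictly below \<open>s\<close>.\<close>
  show ?thesis
    using reversal[of "c - 1"] \<beta>[of "k * c + (c - 1)"] c k by simp
qed

theorem theorem5p4:
  fixes c k :: nat
  assumes "c \<ge> 2" and "k \<ge> 1"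
  shows "fw (concat (replicate k (I_word c)) @ D_word c) = c + 2 * k - 1"
  unfolding fw_def
proof (rule Least_equality)
  show "\<exists>r. \<forall>f :: nat list. is_formation r (c + 2 * k - 1) f \<longrightarrow>
          contains f (concat (replicate k (I_word c)) @ D_word c)"
    using assms(2) by (rule formation_contains_power_rev)
next
  fix s
  assume "\<exists>r. \<forall>f :: nat list. is_formation r s f \<longrightarrow>
            contains f (concat (replicate k (I_word c)) @ D_word c)"
  then obtain r where r: "\<And>f :: nat list. is_formation r s f \<Longrightarrow>
      contains f (concat (replicate k (I_word c)) @ D_word c)" by blast
  \<comment> \<open>For whatever \<open>r\<close> is given, the blocks on \<open>{0..<r}\<close>
    form a formation to which the lower bound applies.\<close>
  have "is_formation r s (concat (map (avoiding_block k r) [0..<s]))"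
    unfolding is_formation_def
    by (intro exI[of _ "{0..<r}"] exI[of _ "map (avoiding_block k r) [0..<s]"])
       (auto simp: avoiding_block_def permutations_of_set_def)
  then show "c + 2 * k - 1 \<le> s"
    using r length_ge_if_contains_power_rev assms by blast
qed

end
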